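(* For every natural number $n$, let $a(n)=\sum_{d\mid n,\ 1\le d\le\sqrt{n}} d$. The abscissa of convergence of the Dirichlet series $L(s,a)=\sum_{n=1}^\infty a(n)n^{-s}$ (with $s=\sigma+it$ complex) is $\alpha=3/2$; that is, the series converges for $\operatorname{Re}(s)>3/2$ and does not converge for $\operatorname{Re}(s)<3/2$. *)

theory Defs
  imports "HOL-Analysis.Analysis" "HOL-Library.Extended_Real"
begin

definition small_divisor_sum :: "nat \<Rightarrow> nat" where
  "small_divisor_sum n = (\<Sum>d | d dvd n \<and> 1 \<le> d \<and> real d \<le> sqrt (real n). d)"

text \<open>
  Convergence means convergence of the ordered partial sums. The shift by \<open>Suc\<close> makes the
  series start at index \<open>1\<close>.
\<close>
definition dirichlet_converges :: "(nat \<Rightarrow> complex) \<Rightarrow> complex \<Rightarrow> bool" where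
  "dirichlet_converges f s \<longleftrightarrow> summable (\<lambda>n. f (Suc n) * of_nat (Suc n) powr (- s))"

text \<open>
  The value is \<open>\<infinity>\<close> if the series converges nowhere and \<open>-\<infinity>\<close> if it converges everywhere.
\<close>
definition conv_abscissa :: "(nat \<Rightarrow> complex) \<Rightarrow> ereal" where
  "conv_abscissa f = (INF s\<in>{s. dirichlet_converges f s}. ereal (Re s))"

end

theory Submission
  imports Defs
begin

text \<open>
  For convergence, \<open>d \<le> \<surd>n\<close> gives \<open>a(n) n\<^sup>-\<^sup>\<sigma> \<le> \<tau>(n) n\<^sup>-\<^sup>p\<close> with \<open>p = \<sigma> - 1/2 > 1\<close> and \<open>\<tau>\<close> the number of
  divisors, and the partial sums of \<open>\<tau>(n) n\<^sup>-\<^sup>p\<close> are bounded by \<open>\<zeta>(p)\<^sup>2\<close>.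

  For divergence at \<open>s = \<sigma> + it\<close> with \<open>\<sigma> < 3/2\<close>, consider the blocks \<open>N < n \<le> N + N/q\<close> with
  \<open>N = (qK)\<^sup>2\<close> and a fixed \<open>q \<ge> \<bar>t\<bar>\<close>. On such a block the argument of \<open>n\<^sup>-\<^sup>s\<close> varies by at most \<open>1\<close>, so
  there is no cancellation, whereas the divisors \<open>d \<le> K\<close> alone give \<open>\<Sum> a(n) \<ge> K\<^sup>3\<close>, which is of the
  order \<open>N\<^bsup>3/2\<^esup>\<close>. Hence the block sums do not tend to \<open>0\<close>.
\<close>

section \<open>Absolute convergence to the right of 3/2\<close>

lemma small_divisor_sum_le:
  assumes "n > 0"
  shows "real (small_divisor_sum n) \<le> sqrt (real n) * real (card {d. d dvd n})"
proof -
  let ?D = "{d. d dvd n \<and> 1 \<le> d \<and> real d \<le> sqrt (real n)}"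
  have fin: "finite {d. d dvd n}" using assms by simp
  have "real (small_divisor_sum n) = (\<Sum>d\<in>?D. real d)"
    unfolding small_divisor_sum_def by simp
  also have "\<dots> \<le> real (card ?D) * sqrt (real n)"
    by (rule sum_bounded_above) auto
  also have "\<dots> \<le> real (card {d. d dvd n}) * sqrt (real n)"
    by (intro mult_right_mono of_nat_mono card_mono fin) auto
  finally show ?thesis by (simp add: mult.commute)
qed

text \<open>Expanding the square gives a sum of nonnegative terms over all pairs in a box. Sending
  \<open>(n, d)\<close> to \<open>(d, n div d)\<close> embeds the divisor pairs in that box, since
  the product of the two entries recovers \<open>n\<close>, and the weight
  \<open>n powr (-p)\<close> splits accordingly.\<close>

lemma sum_divisor_count_powr_le:
  fixes p :: real
  shows "(\<Sum>n=1..N. real (card {d. d dvd n}) * real n powr (-p))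
      \<le> (\<Sum>n=1..N. real n powr (-p))\<^sup>2"
proof -
  let ?S = "SIGMA n:{1..N}. {d. d dvd n}"
  let ?g = "\<lambda>x. (snd x, fst x div snd x)"
  let ?h = "\<lambda>(d, m). real d powr (-p) * real m powr (-p)"
  have inj: "inj_on ?g ?S"
    by (rule inj_onI) (auto elim!: dvdE)
  have sub: "?g ` ?S \<subseteq> {1..N} \<times> {1..N}"
  proof (rule image_subsetI)
    fix x assume "x \<in> ?S"
    then obtain n d where nd: "x = (n, d)" "n \<in> {1..N}" "d dvd n" by auto
    hence "0 < d" "d \<le> n" by (auto intro: dvd_imp_le dvd_pos_nat)
    moreover have "n div d \<le> N" using nd by (auto intro: le_trans[OF div_le_dividend])
    ultimately show "?g x \<in> {1..N} \<times> {1..N}"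
      using nd by (auto simp: Suc_le_eq div_greater_zero_iff)
  qed
  have "(\<Sum>n=1..N. real (card {d. d dvd n}) * real n powr (-p))
      = (\<Sum>n=1..N. \<Sum>d | d dvd n. real n powr (-p))"
    by simp
  also have "\<dots> = (\<Sum>x\<in>?S. real (fst x) powr (-p))"
    by (subst sum.Sigma) (auto simp: case_prod_unfold)
  also have "\<dots> = (\<Sum>x\<in>?S. ?h (?g x))"
    by (intro sum.cong refl) (auto elim!: dvdE simp: powr_mult)
  also have "\<dots> = (\<Sum>x\<in>?g ` ?S. ?h x)"
    by (subst sum.reindex[OF inj]) simp
  also have "\<dots> \<le> (\<Sum>x\<in>{1..N} \<times> {1..N}. ?h x)"
    by (intro sum_mono2 sub) auto
  also have "\<dots> = (\<Sum>n=1..N. real n powr (-p))\<^sup>2"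
    by (simp add: power2_eq_square sum_product sum.cartesian_product)
  finally show ?thesis .
qed

lemma norm_of_nat_powr: "norm (of_nat (Suc n) powr (s::complex)) = real (Suc n) powr Re s"
  by (subst norm_powr_real_powr) (auto simp del: of_nat_Suc)

lemma dirichlet_converges_small_divisor_sum:
  assumes "Re s > 3 / 2"
  shows "dirichlet_converges (\<lambda>n. of_nat (small_divisor_sum n)) s"
proof -
  define p where "p = Re s - 1 / 2"
  have p: "p > 1" using assms by (simp add: p_def)
  let ?a = "\<lambda>n. real (small_divisor_sum n) * real n powr (- Re s)"
  \<comment> \<open>The term at index 0 vanishes because \<open>0 powr (-p) = 0\<close>, so
    \<open>?Z\<close> is \<zeta>(p).\<close>
  let ?Z = "\<Sum>n. real n powr (-p)"
  have zs: "summable (\<lambda>n. real n powr (-p))"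
    using p by (simp add: summable_real_powr_iff)
  have bound: "?a n \<le> real (card {d. d dvd n}) * real n powr (-p)" if "n > 0" for n
  proof -
    have "?a n \<le> (sqrt (real n) * real (card {d. d dvd n})) * real n powr (- Re s)"
      using small_divisor_sum_le[OF that] by (rule mult_right_mono) simp
    also have "\<dots> = real (card {d. d dvd n}) * (real n powr (1/2) * real n powr (- Re s))"
      using that by (simp add: powr_half_sqrt)
    also have "real n powr (1/2) * real n powr (- Re s) = real n powr (-p)"
      by (simp add: powr_add[symmetric] p_def)
    finally show ?thesis .
  qed
  have "(\<Sum>n<N. ?a (Suc n)) \<le> ?Z\<^sup>2" for N
  proof -
    have "(\<Sum>n<N. ?a (Suc n)) = (\<Sum>n=1..N. ?a n)"
      by (rule sum.reindex_bij_witness[of _ "\<lambda>n. n - 1" Suc]) auto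
    also have "\<dots> \<le> (\<Sum>n=1..N. real (card {d. d dvd n}) * real n powr (-p))"
      by (intro sum_mono bound) auto
    also have "\<dots> \<le> (\<Sum>n=1..N. real n powr (-p))\<^sup>2"
      by (rule sum_divisor_count_powr_le)
    also have "\<dots> \<le> ?Z\<^sup>2"
      by (intro power_mono sum_le_suminf zs sum_nonneg) auto
    finally show ?thesis .
  qed
  hence "summable (\<lambda>n. ?a (Suc n))"
    by (intro summableI_nonneg_bounded[where x = "?Z\<^sup>2"]) auto
  hence "summable (\<lambda>n. norm (of_nat (small_divisor_sum (Suc n)) * of_nat (Suc n) powr (- s)))"
    by (simp only: norm_mult norm_of_nat norm_of_nat_powr uminus_complex.simps)
  thus ?thesis
    unfolding dirichlet_converges_def by (rule summable_norm_cancel)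
qed

section \<open>Lower bounds for block sums and divergence to the left of 3/2\<close>

lemma div_le_card_multiples:
  fixes d N L :: nat
  assumes "d > 0"
  shows "L div d \<le> card {n\<in>{N<..N+L}. d dvd n}"
proof -
  let ?f = "\<lambda>i. d * (N div d + i)"
  have sub: "?f ` {1..L div d} \<subseteq> {n\<in>{N<..N+L}. d dvd n}"
  proof safe
    fix i assume i: "i \<in> {1..L div d}"
    \<comment> \<open>As \<open>N mod d < d\<close>, already \<open>i = 1\<close> gives a multiple
      above \<open>N\<close>; as \<open>d * (N div d) \<le> N\<close>, the last one stays within
      \<open>N + L\<close>.\<close>
    have N: "N = d * (N div d) + N mod d" by simp
    have "N mod d < d" using assms by simp
    moreover have "d * 1 \<le> d * i" using i by (intro mult_le_mono) auto
    ultimately have "N < d * (N div d) + d * i" using N by linarith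
    moreover have "d * i \<le> d * (L div d)" using i by (intro mult_le_mono) auto
    hence "d * i \<le> L" using times_div_less_eq_dividend[of d L] by linarith
    hence "d * (N div d) + d * i \<le> N + L" using N by linarith
    ultimately show "d * (N div d + i) \<in> {N<..N+L}" by (simp add: distrib_left)
  qed auto
  have "L div d = card (?f ` {1..L div d})"
    using assms by (subst card_image) (auto intro: inj_onI)
  also have "\<dots> \<le> card {n\<in>{N<..N+L}. d dvd n}"
    by (intro card_mono sub) auto
  finally show ?thesis .
qed

text \<open>Each \<open>d \<le> K\<close> dividing some \<open>n > N\<close> counts towards
  \<open>small_divisor_sum n\<close>, because \<open>d\<^sup>2 \<le> K\<^sup>2 \<le> N\<close>.
  Summed over its multiples in the block, it contributes at least
  \<open>d * (L div d) \<ge> L - K\<close>. Exchanging the two sums adds this up over all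
  \<open>d \<le> K\<close>.\<close>

lemma sum_small_divisor_sum_ge:
  fixes N L K :: nat
  assumes "K\<^sup>2 \<le> N"
  shows "K * (L - K) \<le> (\<Sum>n\<in>{N<..N+L}. small_divisor_sum n)"
proof -
  have "K * (L - K) = (\<Sum>d=1..K. L - K)" by simp
  also have "\<dots> \<le> (\<Sum>d=1..K. d * card {n\<in>{N<..N+L}. d dvd n})"
  proof (rule sum_mono)
    fix d assume d: "d \<in> {1..K}"
    have "L mod d < d" using d by simp
    moreover have "L = d * (L div d) + L mod d" by simp
    ultimately have "L - K \<le> d * (L div d)" using d by (simp only: atLeastAtMost_iff) linarith
    also have "\<dots> \<le> d * card {n\<in>{N<..N+L}. d dvd n}"
      using d by (intro mult_le_mono2 div_le_card_multiples) auto
    finally show "L - K \<le> d * card {n\<in>{N<..N+L}. d dvd n}" .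
  qed
  also have "\<dots> = (\<Sum>d=1..K. \<Sum>n\<in>{N<..N+L}. if d dvd n then d else 0)"
    by (simp add: sum.If_cases Int_def mult.commute)
  also have "\<dots> = (\<Sum>n\<in>{N<..N+L}. \<Sum>d=1..K. if d dvd n then d else 0)"
    by (rule sum.swap)
  also have "\<dots> \<le> (\<Sum>n\<in>{N<..N+L}. small_divisor_sum n)"
  proof (rule sum_mono)
    fix n assume n: "n \<in> {N<..N+L}"
    have "K\<^sup>2 \<le> n" using n assms by simp
    hence "(real K)\<^sup>2 \<le> real n" by (metis of_nat_le_iff of_nat_power)
    hence K: "real K \<le> sqrt (real n)" by (rule real_le_rsqrt)
    have "(\<Sum>d=1..K. if d dvd n then d else 0) = (\<Sum>d\<in>{d\<in>{1..K}. d dvd n}. d)"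
      by (simp add: sum.If_cases Int_def)
    also have "\<dots> \<le> small_divisor_sum n"
      unfolding small_divisor_sum_def
    proof (rule sum_mono2)
      show "finite {d. d dvd n \<and> 1 \<le> d \<and> real d \<le> sqrt (real n)}"
        by (rule finite_subset[of _ "{d. d dvd n}"]) (use n in auto)
    qed (use K in force)+
    finally show "(\<Sum>d=1..K. if d dvd n then d else 0) \<le> small_divisor_sum n" .
  qed
  finally show ?thesis .
qed

lemma cos_ge_half:
  fixes x :: real
  assumes "\<bar>x\<bar> \<le> 1"
  shows "1 / 2 \<le> cos x"
proof -
  have "cos (pi / 3) \<le> cos \<bar>x\<bar>"
    using assms pi_gt3 by (intro cos_monotone_0_pi_le) auto
  thus ?thesis by (simp add: cos_60)
qed

text \<open>The factor \<open>N\<^sup>i\<^sup>t\<close> rotates the whole block towards the positive real axis.\<close>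

lemma Re_rotated_powr_ge:
  fixes s :: complex and N n :: nat
  assumes "N > 0" "N \<le> n" "real n \<le> real N * (1 + 1 / q)" "q > 0" "\<bar>Im s\<bar> \<le> q"
  shows "real n powr (- Re s) / 2 \<le> Re (cis (Im s * ln (real N)) * of_nat n powr (- s))"
proof -
  have n: "n > 0" using assms by simp
  \<comment> \<open>By ln x \<le> x - 1, the logarithm varies by at most \<open>1 / q\<close> on the
    block, so the phase \<open>Im s * ln n\<close> varies by at most 1.\<close>
  have "ln (real n) - ln (real N) = ln (real n / real N)"
    using assms n by (simp add: ln_div)
  also have "\<dots> \<le> real n / real N - 1"
    using assms n by (intro ln_le_minus_one) simp
  also have "\<dots> \<le> 1 / q"
    using assms by (simp add: field_simps)
  finally have "ln (real n) - ln (real N) \<le> 1 / q" .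
  moreover have "ln (real n) - ln (real N) \<ge> 0" using assms by simp
  ultimately have "\<bar>Im s\<bar> * \<bar>ln (real n) - ln (real N)\<bar> \<le> q * (1 / q)"
    using assms by (intro mult_mono) auto
  hence "\<bar>Im s * (ln (real n) - ln (real N))\<bar> \<le> 1"
    unfolding abs_mult using assms by simp
  hence "\<bar>Im s * ln (real N) - Im s * ln (real n)\<bar> \<le> 1"
    by (simp only: right_diff_distrib abs_minus_commute)
  hence c: "1 / 2 \<le> cos (Im s * ln (real N) - Im s * ln (real n))"
    by (rule cos_ge_half)
  have "of_nat n powr (- s) = exp (- s * of_real (ln (real n)))"
    using n by (simp add: powr_def Ln_of_nat)
  also have "\<dots> = of_real (real n powr (- Re s)) * cis (- (Im s * ln (real n)))"
    using n by (simp add: exp_eq_polar powr_def)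
  finally have "Re (cis (Im s * ln (real N)) * of_nat n powr (- s))
      = real n powr (- Re s) * cos (Im s * ln (real N) - Im s * ln (real n))"
    by (simp add: cis_mult mult.left_commute[of "cis _"])
  thus ?thesis
    using mult_left_mono[OF c, of "real n powr (- Re s)"] by simp
qed

lemma not_dirichlet_converges_small_divisor_sum:
  assumes "Re s < 3 / 2"
  shows "\<not> dirichlet_converges (\<lambda>n. of_nat (small_divisor_sum n)) s"
proof
  assume "dirichlet_converges (\<lambda>n. of_nat (small_divisor_sum n)) s"
  hence summ: "summable (\<lambda>n. of_nat (small_divisor_sum (Suc n)) * of_nat (Suc n) powr (- s))"
    (is "summable ?f") unfolding dirichlet_converges_def .
  obtain q0 :: nat where q0: "\<bar>Im s\<bar> \<le> real q0" using real_arch_simple by blast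
  \<comment> \<open>The summand 2 ensures \<open>2 * K\<^sup>2 \<le> L\<close> below, which leaves
    \<open>L - K \<ge> K\<^sup>2\<close>.\<close>
  define q where "q = q0 + 2"
  have q: "q \<ge> 2" "\<bar>Im s\<bar> \<le> real q" using q0 by (auto simp: q_def)
  \<comment> \<open>On the block \<open>n \<le> 2 * N = 2 * q\<^sup>2 * K\<^sup>2\<close>, so
    \<open>n powr (- (3/2)) / 2\<close> is at least \<open>c / K ^ 3\<close>. The power of
    \<open>K\<close> will cancel against the divisor sum, so \<open>c\<close> can be fixed before
    the Cauchy bound \<open>M\<close>.\<close>
  define c where "c = (2 * (real q)\<^sup>2) powr (- (3/2)) / 2"
  have "c > 0" using q by (simp add: c_def)
  then obtain M where M: "\<And>m n. m \<ge> M \<Longrightarrow> norm (sum ?f {m..<n}) < c"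
    using summ unfolding summable_Cauchy by blast
  \<comment> \<open>This makes \<open>K\<close> positive and lets the block start beyond
    \<open>M\<close>.\<close>
  define K where "K = M + 1"
  define N where "N = (q * K)\<^sup>2"
  define L where "L = q * K\<^sup>2"
  have K: "K > 0" by (simp add: K_def)
  have N: "N = q * L" by (simp add: N_def L_def power2_eq_square)
  have L: "L > 0" using q K by (simp add: L_def)
  have "K * 1 \<le> q * K * (q * K)" using q K by (intro mult_le_mono) auto
  hence "M \<le> N" by (simp add: N_def K_def power2_eq_square)
  have KN: "K\<^sup>2 \<le> N" using q by (auto simp: N_def intro!: power_mono)
  have "2 * K\<^sup>2 \<le> L" using q by (simp add: L_def)
  moreover have "K \<le> K\<^sup>2" using K by (simp add: power2_eq_square)
  ultimately have "K\<^sup>2 \<le> L - K" by linarith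
  hence "K * K\<^sup>2 \<le> K * (L - K)" by (rule mult_le_mono2)
  also have "\<dots> \<le> (\<Sum>n\<in>{N<..N+L}. small_divisor_sum n)"
    by (rule sum_small_divisor_sum_ge[OF KN])
  finally have K3: "K ^ 3 \<le> (\<Sum>n\<in>{N<..N+L}. small_divisor_sum n)"
    by (simp add: power2_eq_square power3_eq_cube)

  define w where "w = cis (Im s * ln (real N))"
  have bound: "c / real K ^ 3 \<le> Re (w * of_nat n powr (- s))" if n: "n \<in> {N<..N+L}" for n
  proof -
    have "L \<le> N" using q by (simp add: N)
    hence "real n \<le> 2 * real N" using n by simp
    also have "\<dots> = (2 * (real q)\<^sup>2) * (real K)\<^sup>2" by (simp add: N_def power_mult_distrib)
    finally have up: "real n \<le> (2 * (real q)\<^sup>2) * (real K)\<^sup>2" .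
    have K3': "((real K)\<^sup>2) powr (- (3/2)) = 1 / real K ^ 3"
    proof -
      have "((real K)\<^sup>2) powr (- (3/2)) = real K powr (2 * (- (3/2)))"
        using K by (simp add: powr_powr flip: powr_numeral)
      also have "\<dots> = real K powr (- real 3)" by simp
      also have "\<dots> = 1 / real K ^ 3"
        using K by (subst powr_minus_divide, subst powr_realpow) auto
      finally show ?thesis .
    qed
    have "c / real K ^ 3 = ((2 * (real q)\<^sup>2) * (real K)\<^sup>2) powr (- (3/2)) / 2"
      by (subst powr_mult) (auto simp: c_def K3')
    also have "\<dots> \<le> real n powr (- (3/2)) / 2"
      using up n by (intro divide_right_mono powr_mono2') auto
    \<comment> \<open>The hypothesis \<open>Re s < 3 / 2\<close> enters here, together with
      \<open>n \<ge> 1\<close>.\<close>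
    also have "\<dots> \<le> real n powr (- Re s) / 2"
      using assms n by (intro divide_right_mono powr_mono) auto
    also have "\<dots> \<le> Re (w * of_nat n powr (- s))"
      unfolding w_def
    proof (rule Re_rotated_powr_ge[where q = "real q"])
      have "real n \<le> real N + real L" using n by (simp flip: of_nat_add)
      also have "\<dots> = real N * (1 + 1 / real q)" using q by (simp add: N field_simps)
      finally show "real n \<le> real N * (1 + 1 / real q)" .
    qed (use q n L N in auto)
    finally show ?thesis .
  qed

  have "c = real (K ^ 3) * (c / real K ^ 3)" using K by simp
  also have "\<dots> \<le> real (\<Sum>n\<in>{N<..N+L}. small_divisor_sum n) * (c / real K ^ 3)"
    using K3 \<open>c > 0\<close> by (intro mult_right_mono of_nat_mono) auto
  also have "\<dots> = (\<Sum>n\<in>{N<..N+L}. real (small_divisor_sum n) * (c / real K ^ 3))"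
    by (simp only: sum_distrib_right of_nat_sum)
  also have "\<dots> \<le> (\<Sum>n\<in>{N<..N+L}. real (small_divisor_sum n) * Re (w * of_nat n powr (- s)))"
    by (intro sum_mono mult_left_mono bound) auto
  also have "\<dots> = Re (w * (\<Sum>n\<in>{N<..N+L}. of_nat (small_divisor_sum n) * of_nat n powr (- s)))"
    by (simp add: sum_distrib_left algebra_simps)
  also have "\<dots> \<le> norm (w * (\<Sum>n\<in>{N<..N+L}. of_nat (small_divisor_sum n) * of_nat n powr (- s)))"
    by (rule complex_Re_le_cmod)
  also have "\<dots> = norm (\<Sum>n\<in>{N<..N+L}. of_nat (small_divisor_sum n) * of_nat n powr (- s))"
    by (simp add: norm_mult w_def)
  \<comment> \<open>Index \<open>n\<close> of \<open>?f\<close> carries the term of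
    \<open>Suc n\<close>, so the block becomes half-open on the right.\<close>
  also have "(\<Sum>n\<in>{N<..N+L}. of_nat (small_divisor_sum n) * of_nat n powr (- s)) = sum ?f {N..<N+L}"
    by (rule sum.reindex_bij_witness[of _ Suc "\<lambda>n. n - 1"]) auto
  also have "norm (sum ?f {N..<N+L}) < c"
    by (rule M[OF \<open>M \<le> N\<close>])
  finally show False by simp
qed

theorem theorem3p1:
  shows "conv_abscissa (\<lambda>n. of_nat (small_divisor_sum n)) = ereal (3 / 2) \<and>
    (\<forall>s::complex. Re s > 3 / 2 \<longrightarrow>
      dirichlet_converges (\<lambda>n. of_nat (small_divisor_sum n)) s) \<and>
    (\<forall>s::complex. Re s < 3 / 2 \<longrightarrow>
      \<not> dirichlet_converges (\<lambda>n. of_nat (small_divisor_sum n)) s)"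
proof (intro conjI allI impI)
  let ?S = "{s. dirichlet_converges (\<lambda>n. of_nat (small_divisor_sum n)) s}"
  show "conv_abscissa (\<lambda>n. of_nat (small_divisor_sum n)) = ereal (3 / 2)"
    unfolding conv_abscissa_def
  proof (rule antisym)
    show "ereal (3 / 2) \<le> (INF s\<in>?S. ereal (Re s))"
      using not_dirichlet_converges_small_divisor_sum by (intro INF_greatest) force
    show "(INF s\<in>?S. ereal (Re s)) \<le> ereal (3 / 2)"
    \<comment> \<open>Convergence is established only for \<open>Re s > 3 / 2\<close>, so the
      infimum is approached through the real points \<open>3 / 2 + e\<close>.\<close>
    proof (rule ereal_le_epsilon2)
      fix e :: real assume "e > 0"
      hence "complex_of_real (3 / 2 + e) \<in> ?S"
        using dirichlet_converges_small_divisor_sum[of "complex_of_real (3 / 2 + e)"] by simp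
      hence "(INF s\<in>?S. ereal (Re s)) \<le> ereal (Re (complex_of_real (3 / 2 + e)))"
        by (rule INF_lower)
      thus "(INF s\<in>?S. ereal (Re s)) \<le> ereal (3 / 2) + ereal e" by simp
    qed
  qed
qed (use dirichlet_converges_small_divisor_sum not_dirichlet_converges_small_divisor_sum in auto)

end
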